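(* Let $R$ be a commutative unital ring and let $n\ge 2$ be an integer. If the Bass stable rank of $R$ satisfies $\mathrm{bsr}(R)=1$, then $E_n(R)=\mathrm{SL}_n(R)$, i.e. every matrix in $\mathrm{SL}_n(R)$ is a (finite) product of elementary matrices with entries in $R$.
   Context: An elementary $n\times n$ matrix over $R$ is a matrix with ones on the diagonal and zeros outside the diagonal, except for one off-diagonal entry, which may be an arbitrary element of $R$. $E_n(R)$ denotes the set of those $n\times n$ matrices which are representable as (finite) products of elementary matrices with entries in $R$. Bass stable rank: an element $(x_1,\dots,x_k)\in R^k$ is called unimodular if $\sum_{j=1}^k x_jR=R$; $U_k(R)$ denotes the set of all unimodular elements of $R^k$. An element $(x_1,\dots,x_{k+1})\in U_{k+1}(R)$ is called reducible if there exists $(y_1,\dots,y_k)\in R^k$ such that $(x_1+y_1x_{k+1},\dots,x_k+y_kx_{k+1})\in U_k(R)$. The Bass stable rank $\mathrm{bsr}(R)$ is the least $k\in\mathbb{N}=\{1,2,\dots\}$ such that every $x\in U_{k+1}(R)$ is reducible, and $\mathrm{bsr}(R)=\infty$ if there is no such $k$. *)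

theory Defs
  imports "Jordan_Normal_Form.Determinant" "HOL-Library.Extended_Nat"
begin

definition elementary_matrices :: "nat \<Rightarrow> 'a::comm_ring_1 mat set" where
  "elementary_matrices n =
     {mat n n (\<lambda>(r, s). if r = s then 1 else if r = i \<and> s = j then a else 0) | i j a.
        i < n \<and> j < n \<and> i \<noteq> j}"

definition E :: "nat \<Rightarrow> 'a::comm_ring_1 mat set" where
  "E n = {foldr (*) As (1\<^sub>m n) | As. set As \<subseteq> elementary_matrices n}"

definition SL :: "nat \<Rightarrow> 'a::comm_ring_1 mat set" where
  "SL n = {A \<in> carrier_mat n n. det A = 1}"

definition unimodular_vecs :: "nat \<Rightarrow> 'a::comm_ring_1 vec set" where
  "unimodular_vecs k =
     {x \<in> carrier_vec k. {\<Sum>j<k. x $ j * r $ j | r. r \<in> carrier_vec k} = UNIV}"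

text \<open>Indices start at 0, so the last entry of a vector of dimension \<^term>\<open>Suc k\<close>
  is the one at index \<^term>\<open>k\<close>.\<close>

definition reducible_vec :: "nat \<Rightarrow> 'a::comm_ring_1 vec \<Rightarrow> bool" where
  "reducible_vec k x \<longleftrightarrow>
     (\<exists>y \<in> carrier_vec k. vec k (\<lambda>j. x $ j + y $ j * x $ k) \<in> unimodular_vecs k)"

definition all_reducible :: "'a::comm_ring_1 itself \<Rightarrow> nat \<Rightarrow> bool" where
  "all_reducible _ k \<longleftrightarrow>
     (\<forall>x \<in> (unimodular_vecs (Suc k) :: 'a vec set). reducible_vec k x)"

text \<open>The ring is the type \<^typ>\<open>'a\<close> itself, so the stable rank takes it as a type argument.\<close>

definition bsr :: "'a::comm_ring_1 itself \<Rightarrow> enat" where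
  "bsr R =
     (if \<exists>k\<ge>1. all_reducible R k then enat (LEAST k. k \<ge> 1 \<and> all_reducible R k) else \<infinity>)"

end

theory Submission
  imports Defs
begin

text \<open>
  Stable rank one says that whenever \<open>a x + b y = 1\<close>, some \<open>a + t b\<close> is a unit. This makes
  Gaussian elimination work over the ring with row transvections alone, although an entry of the
  matrix need not be invertible to begin with.

  Suppose that the first \<open>k\<close> columns of \<open>A \<in> SL n\<close> are already those of the identity. The
  inverse of \<open>A\<close> (its adjugate) has a \<open>k\<close>-th row that vanishes to the left of the diagonal, and
  its product with the \<open>k\<close>-th column of \<open>A\<close> is \<open>1\<close>; hence the entries of that column from the
  diagonal downwards generate the unit ideal (\<open>column_tail_unimodular\<close>). By stable rank one, adding
  a combination of the lower rows to row \<open>k\<close> turns the diagonal entry into a unit, and one auxiliary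
  row below then suffices to turn the unit into \<open>1\<close> (\<open>make_pivot_one\<close>). Multiples of row \<open>k\<close>
  clear the rest of the column and leave the first \<open>k\<close> columns intact, as row \<open>k\<close> is zero
  there (\<open>clear_column\<close>). For the last column no auxiliary row is left; but then the matrix is upper
  triangular and its determinant, which is \<open>1\<close>, equals the last diagonal entry
  (\<open>last_pivot_one\<close>).

  The elimination thus ends at the identity. Each step is undone by a step of the same
  kind, so membership in \<open>E n\<close> travels backwards along it, from the identity to \<open>A\<close>.
\<close>

section \<open>Stable rank one\<close>

lemma bsr_eq_1_imp_all_reducible:
  assumes "bsr TYPE('a::comm_ring_1) = 1"
  shows "all_reducible TYPE('a) 1"
proof -
  let ?P = "\<lambda>k. k \<ge> 1 \<and> all_reducible TYPE('a) k"
  from assms have "\<exists>k. ?P k" and "(LEAST k. ?P k) = 1"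
    by (auto simp: bsr_def one_enat_def split: if_splits)
  then have "?P 1" by (metis (mono_tags, lifting) LeastI_ex)
  then show ?thesis by simp
qed

text \<open>For vectors of length one, unimodular means invertible, so reducibility of \<open>(a, b)\<close> provides
  a unit of the form \<open>a + t b\<close>. This is the only way in which the stable rank enters.\<close>

lemma unit_of_bsr_1:
  fixes a b :: "'a::comm_ring_1"
  assumes bsr: "bsr TYPE('a) = 1" and ab: "a * x + b * y = 1"
  obtains t u where "(a + t * b) * u = 1"
proof -
  let ?v = "vec 2 (\<lambda>i. if i = 0 then a else b)"
  have "\<exists>r. z = (\<Sum>j<2. ?v $ j * r $ j) \<and> r \<in> carrier_vec 2" for z
    using arg_cong[OF ab, of "\<lambda>s. s * z"]
    by (intro exI[of _ "vec 2 (\<lambda>i. if i = 0 then x * z else y * z)"])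
      (simp add: numeral_2_eq_2 algebra_simps)
  then have "?v \<in> unimodular_vecs (Suc 1)"
    by (auto simp: unimodular_vecs_def numeral_2_eq_2)
  then have "reducible_vec 1 ?v"
    using bsr_eq_1_imp_all_reducible[OF bsr] by (simp add: all_reducible_def)
  then obtain t where "vec 1 (\<lambda>j. ?v $ j + t $ j * ?v $ 1) \<in> unimodular_vecs 1"
    by (auto simp: reducible_vec_def)
  then have "1 \<in> {\<Sum>j<1. vec 1 (\<lambda>j. ?v $ j + t $ j * ?v $ 1) $ j * r $ j |r. r \<in> carrier_vec 1}"
    unfolding unimodular_vecs_def by blast
  then obtain r where "(a + t $ 0 * b) * r $ 0 = 1"
    by auto
  then show thesis by (rule that)
qed

section \<open>Elementary matrices\<close>

text \<open>Gives access to the known determinant of \<^const>\<open>addrow_mat\<close> and to its action on rows by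
  left multiplication.\<close>

lemma elementary_matrices_eq_addrow_mat:
  "elementary_matrices n = {addrow_mat n a i j | a i j. i < n \<and> j < n \<and> i \<noteq> j}"
proof -
  let ?M = "\<lambda>i j a. mat n n (\<lambda>(r, s). if r = s then 1 else if r = i \<and> s = j then a else 0)"
  have eq: "A = ?M i j a \<and> i < n \<and> j < n \<and> i \<noteq> j \<longleftrightarrow>
    A = addrow_mat n a i j \<and> i < n \<and> j < n \<and> i \<noteq> j" for A :: "'a mat" and i j a
  proof -
    have "?M i j a = addrow_mat n a i j" if "i \<noteq> j"
      using that by (intro eq_matI) auto
    then show ?thesis by auto
  qed
  show ?thesis
    unfolding elementary_matrices_def eq by blast
qed

lemma E_subset_SL: "E n \<subseteq> (SL n :: 'a::comm_ring_1 mat set)"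
proof -
  have "foldr (*) As (1\<^sub>m n) \<in> SL n" if "set As \<subseteq> elementary_matrices n" for As :: "'a mat list"
    using that
  proof (induction As)
    case Nil
    then show ?case by (simp add: SL_def)
  next
    case (Cons A As)
    then have "A \<in> carrier_mat n n" "det A = 1"
      by (auto simp: elementary_matrices_eq_addrow_mat det_addrow_mat)
    with Cons show ?case by (auto simp: SL_def det_mult)
  qed
  then show ?thesis by (auto simp: E_def)
qed

lemma one_in_E: "1\<^sub>m n \<in> E n"
  unfolding E_def by (auto intro!: exI[of _ "[]"])

lemma elementary_times_E:
  assumes "M \<in> elementary_matrices n" "A \<in> E n"
  shows "M * A \<in> E n"
proof -
  from assms(2) obtain As where "A = foldr (*) As (1\<^sub>m n)" "set As \<subseteq> elementary_matrices n"
    by (auto simp: E_def)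
  with assms(1) show ?thesis
    unfolding E_def by (auto intro!: exI[of _ "M # As"])
qed

section \<open>Row reduction by transvections\<close>

definition row_step :: "nat \<Rightarrow> 'a::comm_ring_1 mat \<Rightarrow> 'a mat \<Rightarrow> bool" where
  "row_step n A B \<longleftrightarrow> (\<exists>a i j. i < n \<and> j < n \<and> i \<noteq> j \<and> B = addrow a i j A)"

lemma row_step_SL:
  assumes "row_step n A B" "A \<in> SL n"
  shows "B \<in> SL n"
  using assms by (auto simp: row_step_def SL_def det_addrow)

text \<open>The step that subtracts what was added leads from \<open>B\<close> back to \<open>A\<close>, and it is left
  multiplication by an elementary matrix.\<close>

lemma row_step_E_backward:
  assumes "row_step n A B" "A \<in> carrier_mat n n" "B \<in> E n"
  shows "A \<in> E n"
proof -
  from assms(1) obtain a i j where ij: "i < n" "j < n" "i \<noteq> j" and B: "B = addrow a i j A"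
    by (auto simp: row_step_def)
  have "A = addrow (- a) i j B"
    using ij assms(2) unfolding B by (intro eq_matI) auto
  also have "\<dots> = addrow_mat n (- a) i j * B"
    using ij assms(2) B by (intro addrow_mat) auto
  also have "\<dots> \<in> E n"
    using ij assms(3) by (intro elementary_times_E) (auto simp: elementary_matrices_eq_addrow_mat)
  finally show ?thesis .
qed

abbreviation row_reduces :: "nat \<Rightarrow> 'a::comm_ring_1 mat \<Rightarrow> 'a mat \<Rightarrow> bool" where
  "row_reduces n \<equiv> (row_step n)\<^sup>*\<^sup>*"

lemma row_reduces_SL:
  assumes "row_reduces n A B" "A \<in> SL n"
  shows "B \<in> SL n"
  using assms by (induction) (auto intro: row_step_SL)

lemma row_reduces_E_backward:
  assumes "row_reduces n A B" "A \<in> SL n" "B \<in> E n"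
  shows "A \<in> E n"
  using assms
proof (induction rule: converse_rtranclp_induct)
  case base
  then show ?case by simp
next
  case (step A A')
  then have "A' \<in> E n" by (blast intro: row_step_SL)
  with step.hyps(1) step.prems(1) show ?case
    by (auto intro: row_step_E_backward simp: SL_def)
qed

text \<open>The next two lemmas bundle the steps that share their source row or their target row. In
  both cases the source rows do not change on the way, so the steps do not interfere.\<close>

lemma row_reduces_add_row_multiples:
  assumes A: "A \<in> carrier_mat n n" and l: "l < n" and S: "S \<subseteq> {..<n}" "l \<notin> S"
  shows "row_reduces n A (mat n n (\<lambda>(i, j). A $$ (i, j) + (if i \<in> S then c i * A $$ (l, j) else 0)))"
    (is "row_reduces n A (?B S)")
proof -
  have "finite S" using S finite_subset by blast
  then show ?thesis using S
  proof (induction S)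
    case empty
    have "?B {} = A" using A by (intro eq_matI) auto
    then show ?case by simp
  next
    case (insert m S)
    have "?B (insert m S) = addrow (c m) m l (?B S)"
      using insert l by (intro eq_matI) (auto simp: algebra_simps)
    then have "row_step n (?B S) (?B (insert m S))"
      unfolding row_step_def using insert.prems l by (intro exI[of _ "c m"] exI[of _ m] exI[of _ l]) auto
    with insert show ?case by (auto intro: rtranclp.rtrancl_into_rtrancl)
  qed
qed

lemma row_reduces_add_row_combination:
  assumes A: "A \<in> carrier_mat n n" and l: "l < n" and S: "S \<subseteq> {..<n}" "l \<notin> S"
  shows "row_reduces n A (mat n n (\<lambda>(i, j). A $$ (i, j) + (if i = l then \<Sum>m\<in>S. c m * A $$ (m, j) else 0)))"
    (is "row_reduces n A (?B S)")
proof -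
  have "finite S" using S finite_subset by blast
  then show ?thesis using S
  proof (induction S)
    case empty
    have "?B {} = A" using A by (intro eq_matI) auto
    then show ?case by simp
  next
    case (insert m S)
    have "?B (insert m S) = addrow (c m) l m (?B S)"
      using insert l by (intro eq_matI) (auto simp: algebra_simps)
    then have "row_step n (?B S) (?B (insert m S))"
      unfolding row_step_def using insert.prems l by (intro exI[of _ "c m"] exI[of _ l] exI[of _ m]) auto
    with insert show ?case by (auto intro: rtranclp.rtrancl_into_rtrancl)
  qed
qed

section \<open>Clearing the columns one after the other\<close>

definition cleared :: "nat \<Rightarrow> nat \<Rightarrow> 'a::comm_ring_1 mat \<Rightarrow> bool" where
  "cleared n k A \<longleftrightarrow> (\<forall>i<n. \<forall>j<k. A $$ (i, j) = (if i = j then 1 else 0))"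

text \<open>The witness \<open>b\<close> is row \<open>k\<close> of the inverse of \<open>A\<close>. It annihilates the columns \<open>j < k\<close>, which
  are unit vectors, so its own entries \<open>b j\<close> are zero there and contribute nothing to its
  product with column \<open>k\<close>.\<close>

lemma column_tail_unimodular:
  fixes A :: "'a::comm_ring_1 mat"
  assumes A: "A \<in> SL n" and cl: "cleared n k A" and k: "k < n"
  obtains b where "(\<Sum>i\<in>{k..<n}. b i * A $$ (i, k)) = 1"
proof -
  define b where "b = (\<lambda>i. adj_mat A $$ (k, i))"
  have carr: "A \<in> carrier_mat n n" "adj_mat A \<in> carrier_mat n n" and "adj_mat A * A = 1\<^sub>m n"
    using A adj_mat[of A n] by (auto simp: SL_def)
  then have prod: "(\<Sum>i\<in>{0..<n}. b i * A $$ (i, j)) = (if k = j then 1 else 0)" if "j < n" for j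
  proof -
    have "(adj_mat A * A) $$ (k, j) = (\<Sum>i\<in>{0..<n}. b i * A $$ (i, j))"
      using carr that k by (simp add: scalar_prod_def b_def)
    then show ?thesis
      using \<open>adj_mat A * A = 1\<^sub>m n\<close> that k by simp
  qed
  have "b j = 0" if "j < k" for j
  proof -
    have "(\<Sum>i\<in>{0..<n}. b i * A $$ (i, j)) = (\<Sum>i\<in>{0..<n}. if i = j then b i else 0)"
      using cl that by (intro sum.cong) (auto simp: cleared_def)
    with prod[of j] that k show ?thesis by simp
  qed
  then have "(\<Sum>i\<in>{k..<n}. b i * A $$ (i, k)) = (\<Sum>i\<in>{0..<n}. b i * A $$ (i, k))"
    by (intro sum.mono_neutral_left) auto
  with prod[OF k] that[of b] show thesis by simp
qed

text \<open>The assumption \<open>Suc k < n\<close> provides a row below the pivot. All row operations involve only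
  rows from \<open>k\<close> on, which vanish in the columns before \<open>k\<close>, so those columns survive.\<close>

lemma make_pivot_one:
  fixes A :: "'a::comm_ring_1 mat"
  assumes bsr: "bsr TYPE('a) = 1"
    and A: "A \<in> SL n" and cl: "cleared n k A" and k: "Suc k < n"
  obtains B where "row_reduces n A B" "cleared n k B" "B $$ (k, k) = 1"
proof -
  have carr: "A \<in> carrier_mat n n" using A by (simp add: SL_def)
  obtain b where "(\<Sum>i\<in>{k..<n}. b i * A $$ (i, k)) = 1"
    using column_tail_unimodular[OF A cl] k by auto
  then have "A $$ (k, k) * b k + (\<Sum>i\<in>{Suc k..<n}. b i * A $$ (i, k)) * 1 = 1"
    using k by (simp add: sum.atLeast_Suc_lessThan mult.commute)
  then obtain t u where u: "(A $$ (k, k) + t * (\<Sum>i\<in>{Suc k..<n}. b i * A $$ (i, k))) * u = 1"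
    by (rule unit_of_bsr_1[OF bsr])
  define B where "B = mat n n (\<lambda>(i, j). A $$ (i, j) +
    (if i = k then \<Sum>m\<in>{Suc k..<n}. (t * b m) * A $$ (m, j) else 0))"
  have AB: "row_reduces n A B"
    unfolding B_def using carr k by (intro row_reduces_add_row_combination) auto
  have "B $$ (k, k) = A $$ (k, k) + t * (\<Sum>i\<in>{Suc k..<n}. b i * A $$ (i, k))"
    using k by (simp add: B_def sum_distrib_left mult.assoc)
  with u have unit: "B $$ (k, k) * u = 1" by simp
  have B: "B \<in> carrier_mat n n" by (simp add: B_def)
  have clB: "cleared n k B"
    using cl k by (auto simp: cleared_def B_def)
  \<comment> \<open>A unit pivot \<open>p\<close> cannot be scaled to \<open>1\<close> by a transvection. Being a unit, it can produce
    a \<open>1\<close> in the row below, and \<open>1 - p\<close> times that row corrects the pivot.\<close>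
  define C where "C = addrow ((1 - B $$ (Suc k, k)) * u) (Suc k) k B"
  define D where "D = addrow (1 - B $$ (k, k)) k (Suc k) C"
  have "row_step n B C" "row_step n C D"
    unfolding row_step_def C_def D_def using k by (metis Suc_lessD n_not_Suc_n)+
  with AB have "row_reduces n A D" by auto
  moreover have "cleared n k D"
    using clB B k by (auto simp: cleared_def C_def D_def)
  moreover have "C $$ (Suc k, k) = 1" "C $$ (k, k) = B $$ (k, k)"
    using B k unit by (auto simp: C_def mult.assoc mult.commute[of u])
  then have "D $$ (k, k) = 1"
    using B k by (simp add: D_def C_def)
  ultimately show thesis by (rule that)
qed

lemma clear_column:
  fixes A :: "'a::comm_ring_1 mat"
  assumes A: "A \<in> carrier_mat n n" and cl: "cleared n k A" and k: "k < n" and piv: "A $$ (k, k) = 1"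
  obtains B where "row_reduces n A B" "cleared n (Suc k) B"
proof -
  let ?B = "mat n n (\<lambda>(i, j). A $$ (i, j) +
    (if i \<in> {..<n} - {k} then (- A $$ (i, k)) * A $$ (k, j) else 0))"
  have "row_reduces n A ?B"
    using A k by (intro row_reduces_add_row_multiples) auto
  moreover have "cleared n (Suc k) ?B"
    using cl k piv by (auto simp: cleared_def less_Suc_eq)
  ultimately show thesis by (rule that)
qed

lemma last_pivot_one:
  fixes A :: "'a::comm_ring_1 mat"
  assumes A: "A \<in> SL (Suc k)" and cl: "cleared (Suc k) k A"
  shows "A $$ (k, k) = 1"
proof -
  have carr: "A \<in> carrier_mat (Suc k) (Suc k)" and det: "det A = 1"
    using A by (auto simp: SL_def)
  have "upper_triangular A"
    using carr cl by (auto simp: upper_triangular_def cleared_def)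
  then have "1 = (\<Prod>i = 0..<Suc k. A $$ (i, i))"
    using det det_upper_triangular[OF _ carr] carr by (simp add: prod_list_diag_prod)
  also have "\<dots> = A $$ (k, k)"
    using cl by (simp add: cleared_def)
  finally show ?thesis by simp
qed

text \<open>Induction downwards on \<open>k\<close>: a matrix with all columns cleared is the identity, and one with
  \<open>k\<close> cleared columns reduces to one with \<open>Suc k\<close>.\<close>

lemma cleared_SL_in_E:
  fixes A :: "'a::comm_ring_1 mat"
  assumes bsr: "bsr TYPE('a) = 1" and "k \<le> n" "A \<in> SL n" "cleared n k A"
  shows "A \<in> E n"
  using assms(2-)
proof (induction k arbitrary: A rule: inc_induct)
  case base
  then have "A = 1\<^sub>m n"
    by (intro eq_matI) (auto simp: cleared_def SL_def)
  then show ?case by (simp add: one_in_E)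
next
  case (step k)
  obtain B where B: "row_reduces n A B" "cleared n k B" "B $$ (k, k) = 1"
  proof (cases "Suc k = n")
    case True
    then show thesis
      using that[of A] last_pivot_one[of A k] step.prems by auto
  next
    case False
    then show thesis
      using that make_pivot_one[OF bsr step.prems] step.hyps by (metis Suc_lessI)
  qed
  have "B \<in> SL n" using B(1) step.prems(1) by (rule row_reduces_SL)
  then obtain C where C: "row_reduces n B C" "cleared n (Suc k) C"
    using clear_column[OF _ B(2) _ B(3)] step.hyps by (auto simp: SL_def)
  have "row_reduces n A C" using B(1) C(1) by simp
  moreover have "C \<in> E n"
    using C(2) row_reduces_SL[OF C(1) \<open>B \<in> SL n\<close>] by (intro step.IH)
  ultimately show ?case
    using step.prems(1) by (blast intro: row_reduces_E_backward)
qed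

theorem theorem2:
  fixes n :: nat
  assumes "n \<ge> 2"
    and "bsr TYPE('a::comm_ring_1) = 1"
  shows "E n = (SL n :: 'a mat set)"
proof
  show "E n \<subseteq> (SL n :: 'a mat set)" by (rule E_subset_SL)
  show "SL n \<subseteq> (E n :: 'a mat set)"
    using cleared_SL_in_E[OF assms(2), of 0 n] by (auto simp: cleared_def)
qed

end
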